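(* Let $n,k,p$ be positive integers with $p\le n$. Suppose a cake is to be divided into $n$ pieces and there are $p$ hungry players such that: (1) in every division of the cake into $n$ pieces, each player finds some set of $k$ pieces acceptable; and (2) the players' preference sets are closed. Then there exist a division $x\in\Delta_{n-1}$ of the cake into $n$ pieces, a set $N$ of at least $\left\lceil \frac{p}{2(k^2-k+1)}\right\rceil$ players, and for each player $i\in N$ a $k$-element set $A_i\subseteq[n]$ of pieces acceptable to player $i$ in the division $x$, such that the sets $A_i$ $(i\in N)$ are pairwise disjoint. Moreover, if $p$ divides $n$, then there exist such a division and such a set $N$ of at least $\left\lceil \frac{p}{k^2-k+1}\right\rceil$ players.
   Context: $[n]=\{1,\dots,n\}$. A division of the cake into $n$ pieces is a point $x=(x_1,\dots,x_n)$ of the simplex $\Delta_{n-1}=\{x\in\mathbb{R}^n_{\ge 0}:\sum_{i=1}^n x_i=1\}$, where $x_i$ is the width of piece $i$; piece $i$ is empty if $x_i=0$. Each player $i$ has preferences given by a set $C^i_A\subseteq\Delta_{n-1}$ for each $k$-element subset $A\subseteq[n]$: $A$ is acceptable to (preferred by) player $i$ in the division $x$ iff $x\in C^i_A$; several sets $A$ may be acceptable in the same division. Condition (1) says that for each player $i$ the sets $C^i_A$ cover $\Delta_{n-1}$. Condition (2), closed preference sets, says that every $C^i_A$ is closed: a set of $k$ pieces acceptable for a convergent sequence of divisions is also acceptable in the limiting division. A player is hungry if the player never prefers an empty piece to a non-empty piece: if a $k$-set $A$ is acceptable in the division $x$ and $A$ contains an empty piece, then $A$ contains all the non-empty pieces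 of $x$ (so $A$ consists of non-empty pieces whenever at least $k$ pieces are non-empty). *)

theory Defs
  imports "HOL-Analysis.Analysis"
begin

text \<open>
  The pieces are the elements of a finite type \<open>'n\<close>, which plays the role of \<open>[n]\<close>
  with \<open>n = CARD('n)\<close>; \<open>x $ j\<close> is the width of piece \<open>j\<close>.
\<close>

definition divisions :: "(real ^ 'n::finite) set" where
  "divisions = {x. (\<forall>j. 0 \<le> x $ j) \<and> (\<Sum>j\<in>UNIV. x $ j) = 1}"

definition empty_piece :: "real ^ 'n::finite \<Rightarrow> 'n \<Rightarrow> bool" where
  "empty_piece x j \<longleftrightarrow> x $ j = 0"

text \<open>
  The preferences of one player are a family \<open>C\<close>, where \<open>x \<in> C A\<close> means that the
  \<open>k\<close>-set \<open>A\<close> of pieces is acceptable in the division \<open>x\<close>. Only the values of \<open>C\<close>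
  at \<open>k\<close>-sets carry meaning, so every condition below is restricted to these.
\<close>

type_synonym 'n preferences = "'n set \<Rightarrow> (real ^ 'n) set"

definition preference_family :: "nat \<Rightarrow> 'n::finite preferences \<Rightarrow> bool" where
  "preference_family k C \<longleftrightarrow> (\<forall>A. card A = k \<longrightarrow> C A \<subseteq> divisions)"

definition covering_preferences :: "nat \<Rightarrow> 'n::finite preferences \<Rightarrow> bool" where
  "covering_preferences k C \<longleftrightarrow> (\<forall>x\<in>divisions. \<exists>A. card A = k \<and> x \<in> C A)"

definition closed_preferences :: "nat \<Rightarrow> 'n::finite preferences \<Rightarrow> bool" where
  "closed_preferences k C \<longleftrightarrow> (\<forall>A. card A = k \<longrightarrow> closed (C A))"

definition hungry :: "nat \<Rightarrow> 'n::finite preferences \<Rightarrow> bool" where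
  "hungry k C \<longleftrightarrow> (\<forall>x\<in>divisions. \<forall>A. card A = k \<and> x \<in> C A \<and> (\<exists>j\<in>A. empty_piece x j)
      \<longrightarrow> {j. \<not> empty_piece x j} \<subseteq> A)"

text \<open>
  In the division \<open>x\<close>, every player in \<open>N\<close> can be given an acceptable \<open>k\<close>-set of pieces
  such that no piece is given twice.
\<close>

definition jointly_satisfiable ::
    "nat \<Rightarrow> (nat \<Rightarrow> 'n::finite preferences) \<Rightarrow> real ^ 'n \<Rightarrow> nat set \<Rightarrow> bool" where
  "jointly_satisfiable k C x N \<longleftrightarrow>
     (\<exists>A. (\<forall>i\<in>N. card (A i) = k \<and> x \<in> C i (A i)) \<and> disjoint_family_on A N)"

end

theory Submission
  imports Defs
begin

text \<open>
  The proof first produces a division in which \<open>n\<close> acceptable \<open>k\<close>-sets, one for each of \<open>n\<close>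
  slots occupied by players, cover all pieces evenly in a weighted sense, and then extracts
  many pairwise disjoint sets from this balanced family.

  For the balanced family, suppose that each division \<open>x\<close> is assigned an average \<open>f x\<close> of the vectors
  \<open>1\<^sub>A / k\<close> over acceptable sets \<open>A\<close>, and that \<open>f\<close> is continuous. Brouwer's theorem, applied to the
  map that enlarges the pieces with \<open>f\<^sub>j x < 1/n\<close> and renormalises, gives a division in which
  \<open>x\<^sub>j\<close> is proportional to the shortfall \<open>max 0 (1/n - f\<^sub>j x)\<close>. If some shortfall is positive,
  the non-empty pieces are exactly those with \<open>f\<^sub>j x < 1/n\<close>; but an acceptable set of a hungry
  player lies inside the set \<open>S\<close> of non-empty pieces or contains it, so \<open>f\<close> gives \<open>S\<close> at least
  its proportional share \<open>|S|/n\<close>, a contradiction. Hence \<open>f x\<close> is the constant vector \<open>1/n\<close>.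

  The average has to use only one set per slot. To achieve this, \<open>n - 1\<close> of the coordinates are
  scaled by a large \<open>m\<close>, and \<open>F (\<lfloor>m x + t\<rfloor>)\<close> is integrated over \<open>t\<close> from \<open>0\<close> to \<open>1\<close>. This is the
  piecewise linear interpolation of \<open>F\<close> on Kuhn's triangulation: as \<open>t\<close> grows, \<open>\<lfloor>m x + t\<rfloor>\<close> runs
  through the at most \<open>n\<close> vertices of the simplex that contains \<open>m x\<close>, and their coordinate sums
  are distinct modulo \<open>n\<close>. Letting the slot given by the coordinate sum choose the label of a
  vertex, every slot is asked at most once in each simplex. The labels are chosen in nearby
  divisions only; closedness of the preferences repairs this in the limit
  (\<open>approximate_equilibrium\<close>, \<open>equilibrium\<close>), and hunger is applied to the limit, where the
  sets are acceptable in the division itself (\<open>balanced_equilibrium\<close>).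

  The constancy of \<open>f\<close> says, after rescaling, that there are weights \<open>w\<^sub>s \<ge> 0\<close> with
  \<open>\<Sum>\<^sub>s w\<^sub>s 1[j \<in> A\<^sub>s] = 1\<close> for every piece \<open>j\<close>. Counting incidences with \<open>A\<^sub>s\<close> shows that the
  sets meeting \<open>A\<^sub>s\<close>, itself included, have total weight at most \<open>k - (k - 1) w\<^sub>s\<close>. A weighted
  form of the Caro-Wei bound on independent sets then yields at least
  \<open>\<Sum>\<^sub>s w\<^sub>s / (k - (k - 1) w\<^sub>s)\<close> pairwise disjoint sets. The summand is a convex function of \<open>w\<^sub>s\<close>,
  and the \<open>n\<close> weights have average \<open>1/k\<close>, so Jensen's inequality gives \<open>n / (k\<^sup>2 - k + 1)\<close>. This
  is Fueredi's bound on matchings of hypergraphs, for perfect fractional matchings with at most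
  as many edges as there are vertices (\<open>disjoint_subfamily_of_balanced_family\<close>).

  Finally, each of the \<open>p\<close> players occupies at most \<open>\<lceil>n/p\<rceil>\<close> of the \<open>n\<close> slots, so at least
  \<open>n / (\<lceil>n/p\<rceil> (k\<^sup>2 - k + 1))\<close> different players are served. Now \<open>n / \<lceil>n/p\<rceil>\<close> is at least
  \<open>p/2\<close>, and equals \<open>p\<close> if \<open>p\<close> divides \<open>n\<close>.
\<close>

section \<open>Disjoint members of a balanced family of sets\<close>

text \<open>
  The Caro-Wei bound with vertex weights. The greedy choice of a vertex \<open>v\<close> whose closed
  neighbourhood has the least weight works: the neighbourhood's members then contribute at most
  \<open>\<Sum> w u / w(N v) = 1\<close> to the sum, and removing the neighbourhood only increases the terms of the
  remaining vertices.
\<close>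

lemma weighted_independent_set:
  fixes w :: "'a \<Rightarrow> real" and R :: "'a \<Rightarrow> 'a \<Rightarrow> bool"
  assumes "finite V" and "\<And>v. v \<in> V \<Longrightarrow> 0 < w v"
    and "\<And>v. v \<in> V \<Longrightarrow> R v v" and "\<And>u v. R u v \<Longrightarrow> R v u"
  shows "\<exists>I\<subseteq>V. (\<forall>u\<in>I. \<forall>v\<in>I. u \<noteq> v \<longrightarrow> \<not> R u v)
           \<and> (\<Sum>v\<in>V. w v / (\<Sum>u | u \<in> V \<and> R v u. w u)) \<le> real (card I)"
  using assms(1-3)
proof (induction V rule: finite_psubset_induct)
  case (psubset V)
  define d where "d U v = (\<Sum>u | u \<in> U \<and> R v u. w u)" for U v
  show ?case
  proof (cases "V = {}")
    case True
    then show ?thesis by auto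
  next
    case False
    then obtain v where v: "v \<in> V" and min: "\<And>u. u \<in> V \<Longrightarrow> d V v \<le> d V u"
      using arg_min_if_finite(1)[of V "d V"] arg_min_least[of V _ "d V"] psubset.hyps by blast
    define U where "U = {u \<in> V. \<not> R v u}"
    define B where "B = {u \<in> V. R v u}"
    have VUB: "V = U \<union> B" "U \<inter> B = {}" and fin: "finite U" "finite B"
      using psubset.hyps by (auto simp: U_def B_def)
    have "U \<subset> V" using v psubset.prems(2) by (auto simp: U_def)
    then obtain I where I: "I \<subseteq> U" "\<And>x y. x \<in> I \<Longrightarrow> y \<in> I \<Longrightarrow> x \<noteq> y \<Longrightarrow> \<not> R x y"
        and cI: "(\<Sum>u\<in>U. w u / d U u) \<le> real (card I)"
    proof -
      have *: "0 < w x" "R x x" if "x \<in> U" for x using that psubset.prems by (auto simp: U_def)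
      show thesis using psubset.IH[OF \<open>U \<subset> V\<close> *] that unfolding d_def by blast
    qed
    have dpos: "0 < d X u" if "u \<in> X" "X \<subseteq> V" for X u
      unfolding d_def
    proof (rule sum_pos2[of _ u])
      show "finite {y \<in> X. R u y}" using that(2) psubset.hyps by (auto intro: finite_subset)
    qed (use that psubset.prems in \<open>auto simp: less_imp_le subset_iff\<close>)
    have dmono: "d U u \<le> d V u" for u
      unfolding d_def
      by (rule sum_mono2) (use psubset.hyps psubset.prems in \<open>auto simp: U_def less_imp_le\<close>)
    have "(\<Sum>u\<in>U. w u / d V u) \<le> (\<Sum>u\<in>U. w u / d U u)"
    proof (rule sum_mono)
      fix u assume u: "u \<in> U"
      then have "0 < w u" using psubset.prems by (auto simp: U_def)
      then show "w u / d V u \<le> w u / d U u"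
        using dmono[of u] dpos[OF u] by (intro divide_left_mono) (auto simp: U_def intro!: mult_pos_pos dpos u)
    qed
    moreover have "(\<Sum>u\<in>B. w u / d V u) \<le> (\<Sum>u\<in>B. w u / d V v)"
    proof (rule sum_mono)
      fix u assume u: "u \<in> B"
      then have "u \<in> V" "0 < w u" using psubset.prems by (auto simp: B_def)
      then show "w u / d V u \<le> w u / d V v"
        using min[of u] dpos[of v V] dpos[of u V] v by (intro divide_left_mono) auto
    qed
    moreover have "(\<Sum>u\<in>B. w u / d V v) = 1"
      using dpos[of v V] v by (simp add: sum_divide_distrib[symmetric] B_def d_def)
    moreover have "(\<Sum>u\<in>V. w u / d V u) = (\<Sum>u\<in>U. w u / d V u) + (\<Sum>u\<in>B. w u / d V u)"
      using VUB fin by (simp add: sum.union_disjoint)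
    moreover have "card (insert v I) = Suc (card I)"
    proof -
      have "v \<notin> U" using psubset.prems(2) v by (auto simp: U_def)
      then show ?thesis using I(1) fin by (meson card_insert_disjoint finite_subset subsetD)
    qed
    ultimately have "(\<Sum>u\<in>V. w u / d V u) \<le> real (card (insert v I))"
      using cI by simp
    moreover have "\<forall>x\<in>insert v I. \<forall>y\<in>insert v I. x \<noteq> y \<longrightarrow> \<not> R x y"
      using I assms(4) by (auto simp: U_def)
    moreover have "insert v I \<subseteq> V" using I v by (auto simp: U_def)
    ultimately show ?thesis unfolding d_def by blast
  qed
qed

text \<open>
  The left-hand side is the tangent at \<open>t = 1/k\<close> of the convex function on the right; the proof
  exhibits the difference, cleared of denominators, as a multiple of \<open>(k t - 1)\<^sup>2\<close>. Summed over all weights this is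
  Jensen's inequality.
\<close>

lemma tangent_line_bound:
  fixes k t :: real
  assumes "1 \<le> k" "t \<le> 1"
  shows "(k ^ 3 * t + (1 - k)) / (k\<^sup>2 - k + 1)\<^sup>2 \<le> t / (k - (k - 1) * t)"
proof -
  have "(k - 1) * t \<le> k - 1" using assms mult_left_mono[of t 1 "k - 1"] by simp
  then have D: "0 < k - (k - 1) * t" by simp
  have "k * 1 \<le> k * k" using assms by (intro mult_left_mono) auto
  then have Q: "0 < k\<^sup>2 - k + 1" by (simp add: power2_eq_square)
  have "t * (k\<^sup>2 - k + 1)\<^sup>2 - (k ^ 3 * t + (1 - k)) * (k - (k - 1) * t)
      = k * (k - 1) * (k * t - 1)\<^sup>2"
    by (simp add: power2_eq_square power3_eq_cube algebra_simps)
  moreover have "0 \<le> k * (k - 1) * (k * t - 1)\<^sup>2" using assms by simp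
  ultimately have "(k ^ 3 * t + (1 - k)) * (k - (k - 1) * t) \<le> t * (k\<^sup>2 - k + 1)\<^sup>2" by linarith
  then show ?thesis using D Q by (simp add: frac_le_eq divide_le_eq pos_divide_le_eq le_divide_eq mult.commute)
qed

text \<open>
  The sets meeting a given \<open>A s\<close> cannot have much weight, because every element of \<open>A s\<close> is
  covered with weight exactly \<open>1\<close> and \<open>A s\<close> itself uses up its weight \<open>k\<close> times. This bounds the
  neighbourhoods in the intersection graph, and the independent set bound applies. It is enough
  that there are at most as many sets as elements: by double counting the total weight is
  \<open>|V|/k\<close>, so the average weight is then at least \<open>1/k\<close>.
\<close>

lemma disjoint_subfamily_of_balanced_family:
  fixes A :: "'a \<Rightarrow> 'b set" and w :: "'a \<Rightarrow> real"
  assumes fS: "finite S" and fV: "finite V" and SV: "card S \<le> card V" and k: "1 \<le> k"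
    and A: "\<And>s. s \<in> S \<Longrightarrow> A s \<subseteq> V" "\<And>s. s \<in> S \<Longrightarrow> card (A s) = k"
    and w: "\<And>s. s \<in> S \<Longrightarrow> 0 \<le> w s"
    and balanced: "\<And>v. v \<in> V \<Longrightarrow> (\<Sum>s\<in>S. w s * of_bool (v \<in> A s)) = 1"
  shows "\<exists>I\<subseteq>S. disjoint_family_on A I
           \<and> real (card V) \<le> (real k ^ 2 - real k + 1) * real (card I)"
proof -
  define q where "q = real k ^ 2 - real k + 1"
  have "real k * 1 \<le> real k * real k" using k by (intro mult_left_mono) auto
  then have q: "0 < q" by (simp add: power2_eq_square q_def)
  \<comment> \<open>Sets of weight zero contribute nothing to the bound and are discarded.\<close>
  define T where "T = {s \<in> S. 0 < w s}"
  have fT: "finite T" using fS by (simp add: T_def)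
  define R where "R s s' \<longleftrightarrow> A s \<inter> A s' \<noteq> {}" for s s'
  have Rrefl: "R s s" if "s \<in> T" for s
  proof -
    have "card (A s) \<noteq> 0" using A(2) k that by (auto simp: T_def)
    then show ?thesis by (auto simp: R_def)
  qed
  have sumcard: "(\<Sum>v\<in>X. of_bool (v \<in> A s)) = real (card (X \<inter> A s))" if "finite X" for X s
    using that by (simp add: of_bool_def sum.If_cases Int_def)
  have meet: "(\<Sum>s'\<in>S. w s' * real (card (X \<inter> A s'))) = real (card X)" if X: "X \<subseteq> V" for X
  proof -
    have fX: "finite X" using X fV finite_subset by blast
    have "(\<Sum>s'\<in>S. w s' * real (card (X \<inter> A s'))) = (\<Sum>s'\<in>S. \<Sum>v\<in>X. w s' * of_bool (v \<in> A s'))"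
      by (simp only: sumcard[OF fX, symmetric] sum_distrib_left)
    also have "\<dots> = (\<Sum>v\<in>X. \<Sum>s'\<in>S. w s' * of_bool (v \<in> A s'))" by (rule sum.swap)
    also have "\<dots> = (\<Sum>v\<in>X. 1)" using X balanced by (intro sum.cong) auto
    finally show ?thesis by simp
  qed
  have total: "real k * (\<Sum>s\<in>S. w s) = real (card V)"
  proof -
    have "(\<Sum>s\<in>S. w s * real (card (V \<inter> A s))) = (\<Sum>s\<in>S. w s * real k)"
      using A by (intro sum.cong) (auto simp: Int_absorb1)
    then show ?thesis using meet[of V] by (simp add: sum_distrib_left mult.commute)
  qed
  have finA: "finite (A s)" if "s \<in> S" for s using A(1)[OF that] fV finite_subset by blast
  \<comment> \<open>In the incidence count of \<open>A s\<close> every neighbour counts at least once, and \<open>s\<close> itself \<open>k\<close> times.\<close>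
  have nbh: "(\<Sum>u | u \<in> T \<and> R s u. w u) \<le> real k - (real k - 1) * w s" if s: "s \<in> T" for s
  proof -
    have sS: "s \<in> S" using s by (simp add: T_def)
    have "(\<Sum>u | u \<in> T \<and> R s u. w u) + (real k - 1) * w s
        = (\<Sum>u | u \<in> T \<and> R s u. w u + (if u = s then (real k - 1) * w s else 0))"
      using fT s Rrefl[OF s] by (simp add: sum.distrib)
    also have "\<dots> \<le> (\<Sum>u | u \<in> T \<and> R s u. w u * real (card (A s \<inter> A u)))"
    proof (rule sum_mono)
      fix u assume u: "u \<in> {u. u \<in> T \<and> R s u}"
      show "w u + (if u = s then (real k - 1) * w s else 0) \<le> w u * real (card (A s \<inter> A u))"
      proof (cases "u = s")
        case True
        then show ?thesis using A(2)[OF sS] by (simp add: algebra_simps)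
      next
        case False
        have "card (A s \<inter> A u) \<noteq> 0" using u finA[OF sS] by (auto simp: R_def)
        then have "1 \<le> real (card (A s \<inter> A u))" by linarith
        then show ?thesis using False u mult_left_mono[of 1 "real (card (A s \<inter> A u))" "w u"]
          by (auto simp: T_def)
      qed
    qed
    also have "\<dots> \<le> (\<Sum>u\<in>S. w u * real (card (A s \<inter> A u)))"
      by (rule sum_mono2) (use fS w in \<open>auto simp: T_def\<close>)
    also have "\<dots> = real k" using meet[of "A s"] A sS by simp
    finally show ?thesis by simp
  qed
  have w1: "w s \<le> 1" if s: "s \<in> S" for s
  proof -
    have "A s \<noteq> {}" using A(2)[OF s] k by auto
    then obtain v where v: "v \<in> A s" by blast
    have "w s * of_bool (v \<in> A s) \<le> (\<Sum>s\<in>S. w s * of_bool (v \<in> A s))"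
      by (rule member_le_sum) (use s w fS in auto)
    then show ?thesis using balanced[of v] v A(1)[OF s] by auto
  qed
  obtain I where I: "I \<subseteq> T" "\<forall>u\<in>I. \<forall>v\<in>I. u \<noteq> v \<longrightarrow> \<not> R u v"
    and cI: "(\<Sum>s\<in>T. w s / (\<Sum>u | u \<in> T \<and> R s u. w u)) \<le> real (card I)"
  proof -
    have "0 < w v" if "v \<in> T" for v using that by (simp add: T_def)
    moreover have "R v u" if "R u v" for u v using that by (simp add: R_def Int_commute)
    ultimately show thesis using weighted_independent_set[OF fT, of w R] Rrefl that by blast
  qed
  have "real (card V) / q = (real k ^ 2 * real (card V) + (1 - real k) * real (card V)) / q\<^sup>2"
  proof -
    have "real k ^ 2 * real (card V) + (1 - real k) * real (card V) = q * real (card V)"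
      by (simp add: q_def algebra_simps)
    then show ?thesis using q by (simp add: power2_eq_square)
  qed
  \<comment> \<open>Since \<open>1 - k \<le> 0\<close>, having fewer sets than elements only helps.\<close>
  also have "\<dots> \<le> (real k ^ 2 * real (card V) + (1 - real k) * real (card S)) / q\<^sup>2"
    using k SV by (intro divide_right_mono add_left_mono mult_left_mono_neg) auto
  also have "\<dots> = (\<Sum>s\<in>S. (real k ^ 3 * w s + (1 - real k)) / q\<^sup>2)"
  proof -
    have "real k ^ 2 * real (card V) = (\<Sum>s\<in>S. real k ^ 3 * w s)"
      by (simp add: total[symmetric] sum_distrib_left power2_eq_square power3_eq_cube mult.assoc)
    then show ?thesis by (simp add: sum_divide_distrib[symmetric] sum.distrib mult.commute)
  qed
  also have "\<dots> \<le> (\<Sum>s\<in>S. w s / (real k - (real k - 1) * w s))"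
    unfolding q_def by (intro sum_mono tangent_line_bound) (use k w1 in auto)
  also have "\<dots> = (\<Sum>s\<in>T. w s / (real k - (real k - 1) * w s))"
    by (rule sum.mono_neutral_right) (use fS w in \<open>auto simp: T_def not_less intro: antisym\<close>)
  also have "\<dots> \<le> (\<Sum>s\<in>T. w s / (\<Sum>u | u \<in> T \<and> R s u. w u))"
  proof (rule sum_mono)
    fix s assume s: "s \<in> T"
    have "0 < (\<Sum>u | u \<in> T \<and> R s u. w u)"
      by (rule sum_pos2[of _ s]) (use fS s Rrefl in \<open>auto simp: T_def\<close>)
    then show "w s / (real k - (real k - 1) * w s) \<le> w s / (\<Sum>u | u \<in> T \<and> R s u. w u)"
      using nbh[OF s] s by (intro divide_left_mono mult_pos_pos) (auto simp: T_def)
  qed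
  also note cI
  finally have "real (card V) \<le> q * real (card I)" using q by (simp add: field_simps)
  moreover have "disjoint_family_on A I" using I(2) by (auto simp: disjoint_family_on_def R_def)
  moreover have "I \<subseteq> S" using I(1) by (auto simp: T_def)
  ultimately show ?thesis by (auto simp: q_def)
qed

section \<open>Interpolation on a triangulation with one vertex per class\<close>

text \<open>
  As \<open>t\<close> runs through \<open>[0, 1)\<close>, this enumerates the vertices of the smallest simplex of Kuhn's
  triangulation that contains \<open>m x\<close>. A division is determined by all its coordinates but one,
  so the coordinate \<open>j0\<close> is suppressed (kept at \<open>0\<close>): this leaves a triangulation of an
  \<open>(n - 1)\<close>-dimensional space, whose simplices have \<open>n\<close> vertices.
\<close>

definition grid_vertex :: "'n \<Rightarrow> real \<Rightarrow> real ^ 'n::finite \<Rightarrow> real \<Rightarrow> 'n \<Rightarrow> int" where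
  "grid_vertex j0 m x t = (\<lambda>j. if j = j0 then 0 else \<lfloor>m * x $ j + t\<rfloor>)"

definition coordinate_sum_class :: "('n::finite \<Rightarrow> int) \<Rightarrow> int" where
  "coordinate_sum_class v = (\<Sum>j\<in>UNIV. v j) mod int CARD('n)"

text \<open>
  Between two parameters each coordinate other than \<open>j0\<close> grows by \<open>0\<close> or \<open>1\<close>. The coordinate
  sums of two vertices of a simplex therefore differ by at most \<open>n - 1\<close>, and sums that agree
  modulo \<open>n\<close> agree.
\<close>

lemma grid_vertex_eq_if_same_class:
  fixes x :: "real ^ 'n::finite"
  assumes t: "t \<in> {0..<1}" "t' \<in> {0..<1}"
    and same: "coordinate_sum_class (grid_vertex j0 m x t) = coordinate_sum_class (grid_vertex j0 m x t')"
  shows "grid_vertex j0 m x t = grid_vertex j0 m x t'"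
proof -
  have *: "grid_vertex j0 m x t = grid_vertex j0 m x t'"
    if "t \<le> t'" and t: "t \<in> {0..<1}" "t' \<in> {0..<1}"
      and same: "coordinate_sum_class (grid_vertex j0 m x t) = coordinate_sum_class (grid_vertex j0 m x t')"
    for t t'
  proof -
    define d where "d j = grid_vertex j0 m x t' j - grid_vertex j0 m x t j" for j
    have d0: "0 \<le> d j" for j
      using \<open>t \<le> t'\<close> by (auto simp: d_def grid_vertex_def intro: floor_mono)
    have d1: "d j \<le> of_bool (j \<noteq> j0)" for j
    proof -
      have "\<lfloor>m * x $ j + t'\<rfloor> \<le> \<lfloor>m * x $ j + t + 1\<rfloor>" using t by (intro floor_mono) auto
      then show ?thesis by (auto simp: d_def grid_vertex_def)
    qed
    have "(\<Sum>j\<in>UNIV. d j) \<le> (\<Sum>j\<in>UNIV. of_bool (j \<noteq> j0))" by (rule sum_mono) (rule d1)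
    also have "\<dots> = int (card (UNIV - {j0}))"
      by (simp add: of_bool_def sum.If_cases Compl_eq_Diff_UNIV[symmetric])
        (simp add: Collect_neg_eq Compl_eq_Diff_UNIV)
    also have "\<dots> < int CARD('n)" by (simp add: card_Diff_singleton)
    finally have lt: "(\<Sum>j\<in>UNIV. d j) < int CARD('n)" .
    have "int CARD('n) dvd (\<Sum>j\<in>UNIV. d j)"
      using same unfolding coordinate_sum_class_def d_def sum_subtractf
      by (metis mod_eq_dvd_iff)
    then have "(\<Sum>j\<in>UNIV. d j) = 0"
      using lt sum_nonneg[of UNIV d] d0 by (metis zdvd_not_zless order_le_less)
    then have "d j = 0" for j using d0 by (simp add: sum_nonneg_eq_0_iff)
    then show ?thesis by (auto simp: d_def fun_eq_iff)
  qed
  show ?thesis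
    using *[OF _ t same] *[OF _ t(2) t(1) same[symmetric]] by (metis linear)
qed

definition unit_uniform :: "real measure" where
  "unit_uniform = restrict_space lborel {0..<1}"

lemma space_unit_uniform: "space unit_uniform = {0..<1}"
  by (simp add: unit_uniform_def space_restrict_space)

lemma prob_unit_uniform: "emeasure unit_uniform (space unit_uniform) = 1"
  by (simp add: space_unit_uniform) (simp add: unit_uniform_def emeasure_restrict_space)

lemma finite_measure_unit_uniform: "finite_measure unit_uniform"
  by (rule finite_measureI) (simp add: prob_unit_uniform)

lemma measurable_grid_vertex:
  "(\<lambda>t. grid_vertex j0 m x t) \<in> unit_uniform \<rightarrow>\<^sub>M count_space UNIV"
proof -
  have "(\<lambda>t. grid_vertex j0 m x t) \<in> borel \<rightarrow>\<^sub>M count_space UNIV"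
  proof (subst measurable_count_space_eq2_countable, safe)
    fix v :: "'a \<Rightarrow> int"
    have "(\<lambda>t. grid_vertex j0 m x t) -` {v} \<inter> space borel
        = {t. \<forall>j. (if j = j0 then 0 else \<lfloor>m * x $ j + t\<rfloor>) = v j}"
      by (auto simp: grid_vertex_def fun_eq_iff)
    also have "\<dots> \<in> sets borel" by measurable
    finally show "(\<lambda>t. grid_vertex j0 m x t) -` {v} \<inter> space borel \<in> sets borel" .
  qed auto
  then show ?thesis
    unfolding unit_uniform_def by (intro measurable_restrict_space1) simp
qed

definition interpolate :: "'n::finite \<Rightarrow> real \<Rightarrow> (('n \<Rightarrow> int) \<Rightarrow> real) \<Rightarrow> real ^ 'n \<Rightarrow> real" where
  "interpolate j0 m F x = (\<integral>t. F (grid_vertex j0 m x t) \<partial>unit_uniform)"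

lemma integrable_grid:
  assumes "\<And>v. \<bar>F v\<bar> \<le> (B::real)"
  shows "integrable unit_uniform (\<lambda>t. F (grid_vertex j0 m x t))"
proof (rule finite_measure.integrable_const_bound[OF finite_measure_unit_uniform])
  show "(\<lambda>t. F (grid_vertex j0 m x t)) \<in> borel_measurable unit_uniform"
    using measurable_compose[OF measurable_grid_vertex, of F borel j0 m x] by simp
qed (use assms in auto)

lemma floor_locally_constant:
  assumes "(a::real) \<notin> \<int>" "X \<longlonglongrightarrow> a"
  shows "eventually (\<lambda>i. \<lfloor>X i\<rfloor> = \<lfloor>a\<rfloor>) sequentially"
proof -
  have "real_of_int \<lfloor>a\<rfloor> < a" using assms(1) by (metis Ints_of_int floor_correct less_eq_real_def)
  moreover have "a < real_of_int \<lfloor>a\<rfloor> + 1" by linarith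
  ultimately have "eventually (\<lambda>i. real_of_int \<lfloor>a\<rfloor> < X i \<and> X i < real_of_int \<lfloor>a\<rfloor> + 1) sequentially"
    using assms(2) by (auto intro!: eventually_conj order_tendstoD)
  then show ?thesis by eventually_elim (simp add: floor_eq_iff less_imp_le)
qed

text \<open>
  For fixed \<open>t\<close> the integrand jumps only where some \<open>m x\<^sub>j + t\<close> is an integer. For a given
  \<open>x\<close> this concerns countably many \<open>t\<close>, so dominated convergence applies.
\<close>

lemma continuous_interpolate:
  assumes B: "\<And>v. \<bar>F v\<bar> \<le> B"
  shows "continuous_on S (interpolate j0 m F)"
  unfolding continuous_on_sequentially o_def
proof (safe)
  fix X :: "nat \<Rightarrow> real ^ 'a" and x assume X: "X \<longlonglongrightarrow> x"
  have "(\<lambda>i. \<integral>t. F (grid_vertex j0 m (X i) t) \<partial>unit_uniform)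
      \<longlonglongrightarrow> (\<integral>t. F (grid_vertex j0 m x t) \<partial>unit_uniform)"
  proof (rule integral_dominated_convergence[where w = "\<lambda>_. B"])
    show "(\<lambda>t. F (grid_vertex j0 m y t)) \<in> borel_measurable unit_uniform" for y
      using integrable_grid[of F B j0 m y] B by auto
    then show "(\<lambda>t. F (grid_vertex j0 m (X i) t)) \<in> borel_measurable unit_uniform" for i .
    show "integrable unit_uniform (\<lambda>_. B)"
      using finite_measure.integrable_const finite_measure_unit_uniform by blast
    \<comment> \<open>The parameters at which some coordinate of the vertex jumps at the limit point.\<close>
    define E where "E = (\<Union>j. (\<lambda>z. z - m * x $ j) ` \<int>)"
    have "countable E" unfolding E_def by (auto simp: countable_int)
    then have "AE t in lborel. t \<notin> E"
      by (intro AE_not_in) (auto intro: countable_imp_null_set_lborel)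
    then have "AE t in unit_uniform. t \<notin> E"
      unfolding unit_uniform_def by (subst AE_restrict_space_iff) auto
    then show "AE t in unit_uniform. (\<lambda>i. F (grid_vertex j0 m (X i) t)) \<longlonglongrightarrow> F (grid_vertex j0 m x t)"
    proof eventually_elim
      fix t assume "t \<notin> E"
      have "eventually (\<lambda>i. \<lfloor>m * X i $ j + t\<rfloor> = \<lfloor>m * x $ j + t\<rfloor>) sequentially" for j
      proof (rule floor_locally_constant)
        show "m * x $ j + t \<notin> \<int>"
        proof
          assume "m * x $ j + t \<in> \<int>"
          then have "(m * x $ j + t) - m * x $ j \<in> E" unfolding E_def by blast
          then show False using \<open>t \<notin> E\<close> by simp
        qed
        show "(\<lambda>i. m * X i $ j + t) \<longlonglongrightarrow> m * x $ j + t"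
          by (intro tendsto_intros X)
      qed
      then have "eventually (\<lambda>i. \<forall>j. \<lfloor>m * X i $ j + t\<rfloor> = \<lfloor>m * x $ j + t\<rfloor>) sequentially"
        by (simp add: eventually_all_finite)
      then have "eventually (\<lambda>i. F (grid_vertex j0 m (X i) t) = F (grid_vertex j0 m x t)) sequentially"
      proof eventually_elim
        case (elim i)
        then have "grid_vertex j0 m (X i) t = grid_vertex j0 m x t" by (auto simp: grid_vertex_def)
        then show ?case by simp
      qed
      then show "(\<lambda>i. F (grid_vertex j0 m (X i) t)) \<longlonglongrightarrow> F (grid_vertex j0 m x t)"
        by (rule tendsto_eventually)
    qed
  qed (use B in auto)
  then show "(\<lambda>i. interpolate j0 m F (X i)) \<longlonglongrightarrow> interpolate j0 m F x"
    by (simp add: interpolate_def)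
qed

section \<open>A fixed point at which widths are proportional to shortfalls\<close>

lemma divisions_compact: "compact (divisions :: (real ^ 'n::finite) set)"
proof -
  have "divisions = (\<Inter>j. {x :: real ^ 'n. 0 \<le> x $ j}) \<inter> {x. (\<Sum>j\<in>UNIV. x $ j) = 1}"
    by (auto simp: divisions_def)
  moreover have "closed ((\<Inter>j. {x :: real ^ 'n. 0 \<le> x $ j}) \<inter> {x. (\<Sum>j\<in>UNIV. x $ j) = 1})"
    by (intro closed_Int closed_INT ballI closed_Collect_le closed_Collect_eq continuous_intros)
  moreover have "bounded (divisions :: (real ^ 'n) set)"
  proof (rule boundedI)
    fix x :: "real ^ 'n" assume "x \<in> divisions"
    then have "(\<Sum>j\<in>UNIV. \<bar>x $ j\<bar>) = 1" by (simp add: divisions_def)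
    then show "norm x \<le> 1" using norm_le_l1_cart[of x] by simp
  qed
  ultimately show ?thesis by (simp add: compact_eq_bounded_closed)
qed

lemma divisions_convex: "convex (divisions :: (real ^ 'n::finite) set)"
  unfolding convex_def divisions_def
  by (auto simp: sum.distrib sum_distrib_left[symmetric])

lemma divisions_nonempty: "(divisions :: (real ^ 'n::finite) set) \<noteq> {}"
proof -
  have "(\<chi> j. 1 / real CARD('n)) \<in> (divisions :: (real ^ 'n) set)" by (simp add: divisions_def)
  then show ?thesis by blast
qed

text \<open>
  The Brouwer map adds to each width its shortfall against the target \<open>c\<close> and renormalises.
\<close>

lemma shortfall_fixed_point:
  fixes f :: "'n::finite \<Rightarrow> real ^ 'n \<Rightarrow> real"
  assumes "\<And>j. continuous_on divisions (f j)"
  shows "\<exists>x\<in>divisions. \<forall>j. x $ j * (\<Sum>i\<in>UNIV. max 0 (c i - f i x)) = max 0 (c j - f j x)"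
proof -
  define g where "g j x = max 0 (c j - f j x)" for j x
  define th where "th x = (\<Sum>i\<in>UNIV. g i x)" for x
  have g0: "0 \<le> g j x" for j x by (simp add: g_def)
  then have th: "0 < 1 + th x" for x by (simp add: th_def add_pos_nonneg sum_nonneg)
  define h where "h x = (\<chi> j. (x $ j + g j x) / (1 + th x))" for x
  have "continuous_on divisions (g j)" for j unfolding g_def by (intro continuous_intros assms)
  then have "continuous_on divisions h"
    unfolding h_def using th
    by (intro continuous_on_vec_lambda continuous_intros) (auto simp: th_def less_le intro!: continuous_intros)
  moreover have "h \<in> divisions \<rightarrow> divisions"
  proof
    fix x :: "real ^ 'n" assume x: "x \<in> divisions"
    have "(\<Sum>j\<in>UNIV. h x $ j) = (1 + th x) / (1 + th x)"
      using x by (simp add: h_def sum_divide_distrib[symmetric] sum.distrib th_def divisions_def)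
    then show "h x \<in> divisions"
      using x g0 th[of x] by (simp add: divisions_def h_def divide_nonneg_pos)
  qed
  ultimately obtain x where x: "x \<in> divisions" "h x = x"
    using brouwer[OF divisions_compact divisions_convex divisions_nonempty] by blast
  have "x $ j * th x = g j x" for j
  proof -
    have "h x $ j * (1 + th x) = x $ j + g j x" using th[of x] by (simp add: h_def)
    then show ?thesis using x(2) by (simp add: algebra_simps)
  qed
  then show ?thesis using x(1) by (auto simp: th_def g_def)
qed

section \<open>The slots at the vertices of a cell\<close>

text \<open>
  The slots are identified with the elements of \<open>'n\<close>, and \<open>idx\<close> numbers them by the classes of
  coordinate sums. The weight \<open>l $ s\<close> is the measure of the parameters \<open>t\<close> whose vertex is in the
  class of \<open>s\<close>; all of them give the same vertex \<open>v s\<close>, so that an interpolated value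
  is a convex combination with one term per slot. A slot of weight zero need not own a
  vertex, and then \<open>v s\<close> is arbitrary.
\<close>

lemma cell_of_point:
  fixes x :: "real ^ 'n::finite" and idx :: "'n \<Rightarrow> nat"
  assumes idx: "bij_betw idx UNIV {..<CARD('n)}"
  obtains l v where "l \<in> divisions"
    and "\<And>s. l $ s \<noteq> 0 \<Longrightarrow> coordinate_sum_class (v s) = int (idx s)
               \<and> (\<exists>t\<in>{0..<1}. v s = grid_vertex j0 m x t)"
    and "\<And>F. interpolate j0 m F x = (\<Sum>s\<in>UNIV. l $ s * F (v s))"
proof -
  define has_class where "has_class s u \<longleftrightarrow> coordinate_sum_class u = int (idx s)"
    for s and u :: "'n \<Rightarrow> int"
  define l where "l = (\<chi> s. interpolate j0 m (\<lambda>u. of_bool (has_class s u)) x)"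
  define v where "v s = (SOME u. has_class s u \<and> (\<exists>t\<in>{0..<1}. u = grid_vertex j0 m x t))" for s
  have ex1: "\<exists>!s. has_class s u" for u
  proof -
    have r: "0 \<le> coordinate_sum_class u" "coordinate_sum_class u < int CARD('n)"
      by (simp_all add: coordinate_sum_class_def)
    then have "nat (coordinate_sum_class u) \<in> idx ` UNIV"
      using idx by (simp add: bij_betw_def nat_less_iff)
    then obtain s where "idx s = nat (coordinate_sum_class u)" by (metis imageE)
    then have "has_class s u" using r by (simp add: has_class_def)
    moreover have "s' = s" if "has_class s' u" for s'
      using that \<open>has_class s u\<close> idx by (auto simp: has_class_def bij_betw_def dest: injD)
    ultimately show ?thesis by blast
  qed
  have v: "v s = grid_vertex j0 m x t" if "t \<in> {0..<1}" "has_class s (grid_vertex j0 m x t)" for s t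
  proof -
    have "has_class s (v s) \<and> (\<exists>t\<in>{0..<1}. v s = grid_vertex j0 m x t)"
      unfolding v_def by (rule someI2[of _ "grid_vertex j0 m x t"]) (use that in auto)
    then obtain t' where "t' \<in> {0..<1}" "v s = grid_vertex j0 m x t'" "has_class s (v s)" by blast
    then show ?thesis
      using grid_vertex_eq_if_same_class[of t' t j0 m x] that by (simp add: has_class_def)
  qed
  have int: "integrable unit_uniform (\<lambda>t. of_bool (has_class s (grid_vertex j0 m x t)) :: real)" for s
    by (rule integrable_grid[of "\<lambda>u. of_bool (has_class s u)" 1]) simp
  have F: "interpolate j0 m F x = (\<Sum>s\<in>UNIV. l $ s * F (v s))" for F
  proof -
    have "F (grid_vertex j0 m x t)
        = (\<Sum>s\<in>UNIV. of_bool (has_class s (grid_vertex j0 m x t)) * F (v s))"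
      if t: "t \<in> space unit_uniform" for t
    proof -
      obtain s0 where s0: "has_class s0 (grid_vertex j0 m x t)"
        "\<And>s. has_class s (grid_vertex j0 m x t) \<Longrightarrow> s = s0"
        using ex1[of "grid_vertex j0 m x t"] by (elim ex1E) blast
      have "has_class s (grid_vertex j0 m x t) \<longleftrightarrow> s = s0" for s using s0 by blast
      then have "(\<Sum>s\<in>UNIV. of_bool (has_class s (grid_vertex j0 m x t)) * F (v s))
          = (\<Sum>s\<in>UNIV. if s = s0 then F (v s) else 0)"
        by (intro sum.cong) auto
      then show ?thesis using v[OF _ s0(1)] t by (simp add: space_unit_uniform)
    qed
    then have "interpolate j0 m F x
        = (\<integral>t. (\<Sum>s\<in>UNIV. of_bool (has_class s (grid_vertex j0 m x t)) * F (v s)) \<partial>unit_uniform)"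
      unfolding interpolate_def by (intro Bochner_Integration.integral_cong) auto
    also have "\<dots> = (\<Sum>s\<in>UNIV. (\<integral>t. of_bool (has_class s (grid_vertex j0 m x t)) * F (v s) \<partial>unit_uniform))"
      by (intro Bochner_Integration.integral_sum integrable_mult_left int)
    also have "\<dots> = (\<Sum>s\<in>UNIV. l $ s * F (v s))"
      by (simp add: l_def interpolate_def)
    finally show ?thesis .
  qed
  have "interpolate j0 m (\<lambda>_. 1) x = 1"
    using prob_unit_uniform by (simp add: interpolate_def measure_def)
  then have "l \<in> divisions"
    using F[of "\<lambda>_. 1"] by (auto simp: divisions_def l_def interpolate_def intro!: Bochner_Integration.integral_nonneg)
  moreover have "has_class s (v s) \<and> (\<exists>t\<in>{0..<1}. v s = grid_vertex j0 m x t)" if "l $ s \<noteq> 0" for s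
  proof (rule ccontr)
    assume *: "\<not> ?thesis"
    have "\<not> has_class s (grid_vertex j0 m x t)" if "t \<in> {0..<1}" for t
      using * v[OF that] that by metis
    then have "(\<integral>t. of_bool (has_class s (grid_vertex j0 m x t)) \<partial>unit_uniform) = (\<integral>t. (0::real) \<partial>unit_uniform)"
      by (intro Bochner_Integration.integral_cong) (auto simp: space_unit_uniform)
    then show False using that by (simp add: l_def interpolate_def)
  qed
  ultimately show thesis using that F unfolding has_class_def by blast
qed

section \<open>Equilibria of closed preferences\<close>

text \<open>
  The number written \<open>f\<^sub>j\<close> in the introduction, for an average with weights \<open>l\<close> over the
  sets \<open>A s\<close>.
\<close>

definition share :: "nat \<Rightarrow> real ^ 'n::finite \<Rightarrow> ('n \<Rightarrow> 'n set) \<Rightarrow> 'n \<Rightarrow> real" where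
  "share k l A j = (\<Sum>s\<in>UNIV. l $ s * of_bool (j \<in> A s)) / real k"

definition shortfall :: "nat \<Rightarrow> real ^ 'n::finite \<Rightarrow> ('n \<Rightarrow> 'n set) \<Rightarrow> 'n \<Rightarrow> real" where
  "shortfall k l A j = max 0 (1 / real CARD('n) - share k l A j)"

text \<open>
  The coordinate \<open>j0\<close>, to which the bound \<open>d\<close> does not apply, is controlled because the coordinates of
  both divisions sum to \<open>1\<close>.
\<close>

lemma dist_divisions_le:
  fixes x z :: "real ^ 'n::finite"
  assumes "x \<in> divisions" "z \<in> divisions" and "\<And>j. j \<noteq> j0 \<Longrightarrow> \<bar>z $ j - x $ j\<bar> \<le> d" "0 \<le> d"
  shows "dist z x \<le> 2 * real CARD('n) * d"
proof -
  have "(\<Sum>j\<in>UNIV - {j0}. \<bar>(z - x) $ j\<bar>) \<le> (\<Sum>j\<in>UNIV - {j0}. d)"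
    by (rule sum_mono) (use assms(3) in auto)
  also have "\<dots> \<le> real CARD('n) * d"
    using assms(4) by (simp add: card_Diff_singleton mult_right_mono)
  finally have rest: "(\<Sum>j\<in>UNIV - {j0}. \<bar>(z - x) $ j\<bar>) \<le> real CARD('n) * d" .
  have "(\<Sum>j\<in>UNIV. (z - x) $ j) = 0"
    using assms(1,2) by (simp add: divisions_def sum_subtractf)
  then have "(z - x) $ j0 = - (\<Sum>j\<in>UNIV - {j0}. (z - x) $ j)"
    by (subst (asm) sum.remove[of _ j0]) auto
  then have "\<bar>(z - x) $ j0\<bar> \<le> (\<Sum>j\<in>UNIV - {j0}. \<bar>(z - x) $ j\<bar>)"
    using sum_abs[of "\<lambda>j. (z - x) $ j" "UNIV - {j0}"] by simp
  moreover have "(\<Sum>j\<in>UNIV. \<bar>(z - x) $ j\<bar>)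
      = \<bar>(z - x) $ j0\<bar> + (\<Sum>j\<in>UNIV - {j0}. \<bar>(z - x) $ j\<bar>)"
    by (subst sum.remove[of _ j0]) auto
  ultimately show ?thesis
    using rest norm_le_l1_cart[of "z - x"] by (simp add: dist_norm)
qed

text \<open>
  Each grid vertex near some division is labelled with a set that the slot of its class accepts
  in a nearby division, and the fixed point is taken for the interpolation of the labels. The
  accepting divisions lie within \<open>e\<close> of the fixed point, but may have other empty pieces; this is
  why the conclusion records how widths and shortfalls are related and leaves its use to the
  limit.
\<close>

lemma approximate_equilibrium:
  fixes D :: "'n::finite \<Rightarrow> 'n preferences"
  assumes k: "1 \<le> k" and cov: "\<And>s. covering_preferences k (D s)" and e: "0 < e"
  shows "\<exists>x\<in>divisions. \<exists>l\<in>divisions. \<exists>A.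
           (\<forall>s. card (A s) = k \<and> (\<exists>z\<in>D s (A s). dist z x \<le> e))
           \<and> (\<forall>j. x $ j * (\<Sum>i\<in>UNIV. shortfall k l A i) = shortfall k l A j)"
proof -
  obtain h :: "'n \<Rightarrow> nat" where "bij_betw h UNIV {0..<CARD('n)}"
    using ex_bij_betw_finite_nat[of "UNIV :: 'n set"] by auto
  then have idx: "bij_betw h UNIV {..<CARD('n)}" by (simp add: atLeast0LessThan)
  define j0 :: 'n where "j0 = undefined"
  define n where "n = real CARD('n)"
  have n: "0 < n" by (simp add: n_def)
  \<comment> \<open>A grid vertex of the cell of \<open>x\<close> and a division near that vertex differ from \<open>x\<close> by at most
      \<open>1/m\<close> and \<open>2/m\<close> in the coordinates other than \<open>j0\<close>, hence by \<open>4 n / m\<close> in distance.\<close>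
  define m where "m = 4 * n / e"
  have m: "0 < m" using n e by (simp add: m_def)
  define near where "near z u \<longleftrightarrow> z \<in> divisions \<and> (\<forall>j. j \<noteq> j0 \<longrightarrow> \<bar>m * z $ j - real_of_int (u j)\<bar> \<le> 1)"
    for z :: "real ^ 'n" and u
  have "\<exists>B. card B = k \<and> (\<forall>s. coordinate_sum_class u = int (h s) \<longrightarrow> (\<exists>z. near z u) \<longrightarrow> (\<exists>z\<in>D s B. near z u))" for u
  proof (cases "\<exists>s z. coordinate_sum_class u = int (h s) \<and> near z u")
    case True
    then obtain s z where sz: "coordinate_sum_class u = int (h s)" "near z u" by blast
    then obtain B where B: "card B = k" "z \<in> D s B"
      using cov[of s] by (auto simp: covering_preferences_def near_def)
    have "s' = s" if "coordinate_sum_class u = int (h s')" for s'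
      using that sz(1) idx by (auto simp: bij_betw_def dest: injD)
    then show ?thesis using B sz by blast
  next
    case False
    obtain B :: "'n set" where "card B = k"
      using cov divisions_nonempty by (fastforce simp: covering_preferences_def)
    then show ?thesis using False by blast
  qed
  then obtain L where L: "\<And>u. card (L u) = k"
    "\<And>u s z. coordinate_sum_class u = int (h s) \<Longrightarrow> near z u \<Longrightarrow> \<exists>z\<in>D s (L u). near z u"
    by metis
  have "\<exists>x\<in>divisions. \<forall>j. x $ j * (\<Sum>i\<in>UNIV. max 0 (1 / n - interpolate j0 m (\<lambda>u. of_bool (i \<in> L u)) x / real k))
      = max 0 (1 / n - interpolate j0 m (\<lambda>u. of_bool (j \<in> L u)) x / real k)"
    by (rule shortfall_fixed_point) (use k in \<open>auto intro!: continuous_intros continuous_interpolate[where B=1]\<close>)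
  then obtain x where x: "x \<in> divisions" and
    fixp: "\<And>j. x $ j * (\<Sum>i\<in>UNIV. max 0 (1 / n - interpolate j0 m (\<lambda>u. of_bool (i \<in> L u)) x / real k))
      = max 0 (1 / n - interpolate j0 m (\<lambda>u. of_bool (j \<in> L u)) x / real k)" by blast
  obtain l v where l: "l \<in> divisions"
    and v: "\<And>s. l $ s \<noteq> 0 \<Longrightarrow> coordinate_sum_class (v s) = int (h s)
               \<and> (\<exists>t\<in>{0..<1}. v s = grid_vertex j0 m x t)"
    and F: "\<And>F. interpolate j0 m F x = (\<Sum>s\<in>UNIV. l $ s * F (v s))"
    by (rule cell_of_point[OF idx, where x = x and ?j0.0 = j0 and m = m]) blast
  \<comment> \<open>A slot of weight zero may be given any set that it accepts in \<open>x\<close> itself.\<close>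
  have "\<exists>B. card B = k \<and> (l $ s \<noteq> 0 \<longrightarrow> B = L (v s)) \<and> (\<exists>z\<in>D s B. dist z x \<le> e)" for s
  proof (cases "l $ s = 0")
    case True
    then show ?thesis using cov[of s] x e by (force simp: covering_preferences_def)
  next
    case False
    then obtain t where t: "t \<in> {0..<1}" "v s = grid_vertex j0 m x t" using v by blast
    have x_near: "\<bar>m * x $ j - real_of_int (v s j)\<bar> \<le> 1" if "j \<noteq> j0" for j
    proof -
      have "v s j = \<lfloor>m * x $ j + t\<rfloor>" using t that by (simp add: grid_vertex_def)
      then show ?thesis using t(1) by (auto simp: abs_le_iff) linarith+
    qed
    then have "near x (v s)" using x by (simp add: near_def)
    then obtain z where z: "z \<in> D s (L (v s))" "near z (v s)" using L(2) v False by blast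
    have "\<bar>z $ j - x $ j\<bar> \<le> 2 / m" if "j \<noteq> j0" for j
    proof -
      have "\<bar>m * z $ j - real_of_int (v s j)\<bar> \<le> 1" using z(2) that by (simp add: near_def)
      then have "\<bar>m * z $ j - m * x $ j\<bar> \<le> 2" using x_near[OF that] by linarith
      moreover have "\<bar>m * z $ j - m * x $ j\<bar> = m * \<bar>z $ j - x $ j\<bar>"
        using m by (simp add: right_diff_distrib[symmetric] abs_mult)
      ultimately show ?thesis using m by (simp add: pos_le_divide_eq mult.commute)
    qed
    then have "dist z x \<le> 2 * real CARD('n) * (2 / m)"
      using z(2) x m by (intro dist_divisions_le[of x z j0]) (auto simp: near_def)
    also have "\<dots> = e" using n e by (simp add: m_def n_def)
    finally show ?thesis using z(1) L(1) by blast
  qed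
  then obtain A where A: "\<And>s. card (A s) = k" "\<And>s. l $ s \<noteq> 0 \<Longrightarrow> A s = L (v s)"
      "\<And>s. \<exists>z\<in>D s (A s). dist z x \<le> e"
    by metis
  have "interpolate j0 m (\<lambda>u. of_bool (j \<in> L u)) x / real k = share k l A j" for j
  proof -
    have "l $ s * of_bool (j \<in> L (v s)) = l $ s * of_bool (j \<in> A s)" for s
      using A(2)[of s] by (cases "l $ s = 0") auto
    then show ?thesis unfolding share_def F by (intro arg_cong2[where f = divide] sum.cong) auto
  qed
  then have "\<forall>j. x $ j * (\<Sum>i\<in>UNIV. shortfall k l A i) = shortfall k l A j"
    using fixp by (simp add: shortfall_def n_def)
  then show ?thesis using x l A by blast
qed

text \<open>
  There are finitely many assignments of sets to slots, so one of them occurs for infinitely many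
  of the approximate equilibria with errors tending to \<open>0\<close>; divisions and weights converge along a
  subsequence. Proportionality of widths and shortfalls is a closed condition.
\<close>

lemma equilibrium:
  fixes D :: "'n::finite \<Rightarrow> 'n preferences"
  assumes k: "1 \<le> k" and cov: "\<And>s. covering_preferences k (D s)"
    and cl: "\<And>s. closed_preferences k (D s)"
  shows "\<exists>x\<in>divisions. \<exists>l\<in>divisions. \<exists>A.
           (\<forall>s. card (A s) = k \<and> x \<in> D s (A s))
           \<and> (\<forall>j. x $ j * (\<Sum>i\<in>UNIV. shortfall k l A i) = shortfall k l A j)"
proof -
  have "\<exists>x l A. x \<in> divisions \<and> l \<in> divisions \<and>
           (\<forall>s. card (A s) = k \<and> (\<exists>z\<in>D s (A s). dist z x \<le> inverse (real (Suc i))))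
           \<and> (\<forall>j. x $ j * (\<Sum>i\<in>UNIV. shortfall k l A i) = shortfall k l A j)" for i
    proof -
    have "0 < inverse (real (Suc i))" by simp
    then show ?thesis using approximate_equilibrium[of k D "inverse (real (Suc i))", OF k cov] by blast
  qed
  then obtain X l B where
    XL: "\<And>i. X i \<in> divisions" "\<And>i. l i \<in> divisions" and
    B: "\<And>i s. card (B i s) = k"
      "\<And>i s. \<exists>z\<in>D s (B i s). dist z (X i) \<le> inverse (real (Suc i))" and
    eq: "\<And>i j. X i $ j * (\<Sum>a\<in>UNIV. shortfall k (l i) (B i) a) = shortfall k (l i) (B i) j"
    by metis
  have "\<exists>a0\<in>UNIV. \<not> finite {a \<in> UNIV. B a = B a0}"
    by (rule pigeonhole_infinite) auto
  then obtain a0 where "infinite {i. B i = B a0}" by auto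
  then obtain r :: "nat \<Rightarrow> nat" where r: "strict_mono r" "\<forall>i. r i \<in> {i. B i = B a0}"
    using infinite_enumerate by blast
  define A where "A = B a0"
  have "seq_compact (divisions \<times> divisions :: ((real ^ 'n) \<times> (real ^ 'n)) set)"
    by (intro compact_imp_seq_compact compact_Times divisions_compact)
  then obtain p q where p: "p \<in> divisions \<times> divisions" "strict_mono q"
      and lim: "((\<lambda>i. (X (r i), l (r i))) \<circ> q) \<longlonglongrightarrow> p"
    by (rule seq_compactE[where f = "\<lambda>i. (X (r i), l (r i))"]) (use XL in auto)
  obtain x L where xL: "p = (x, L)" by (cases p)
  define g where "g i = r (q i)" for i
  have g: "strict_mono g" using r(1) p(2) by (auto simp: g_def strict_mono_def)
  have limX: "(\<lambda>i. X (g i)) \<longlonglongrightarrow> x" and limL: "(\<lambda>i. l (g i)) \<longlonglongrightarrow> L"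
    using tendsto_fst[OF lim] tendsto_snd[OF lim] by (simp_all add: xL o_def g_def)
  have BA: "B (g i) = A" for i using r(2) by (simp add: g_def A_def)
  have "x \<in> D s (A s)" for s
  proof -
    have "closed (D s (A s))" using cl[of s] B(1) by (auto simp: closed_preferences_def A_def)
    moreover have "\<exists>z\<in>D s (A s). dist z x < e" if "0 < e" for e
    proof -
      have "eventually (\<lambda>i. dist (X (g i)) x < e / 2) sequentially"
        using limX that by (auto dest: tendstoD[of _ _ _ "e / 2"])
      moreover have "(\<lambda>i. inverse (real (Suc (g i)))) \<longlonglongrightarrow> 0"
        using LIMSEQ_subseq_LIMSEQ[OF LIMSEQ_inverse_real_of_nat g] by (simp add: o_def)
      then have "eventually (\<lambda>i. inverse (real (Suc (g i))) < e / 2) sequentially"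
        using that by (intro order_tendstoD) auto
      ultimately have "eventually (\<lambda>i. dist (X (g i)) x < e / 2 \<and> inverse (real (Suc (g i))) < e / 2) sequentially"
        by (rule eventually_conj)
      then obtain i where i: "dist (X (g i)) x < e / 2" "inverse (real (Suc (g i))) < e / 2"
        using eventually_happens'[OF sequentially_bot] by blast
      obtain z where z: "z \<in> D s (A s)" "dist z (X (g i)) \<le> inverse (real (Suc (g i)))"
        using B(2)[of s "g i"] BA by auto
      have "dist z x < e" using dist_triangle[of z x "X (g i)"] i z by linarith
      then show ?thesis using z by blast
    qed
    ultimately show ?thesis using closed_approachable by blast
  qed
  moreover have "x $ j * (\<Sum>i\<in>UNIV. shortfall k L A i) = shortfall k L A j" for j
  proof -
    have sf: "(\<lambda>i. shortfall k (l (g i)) A a) \<longlonglongrightarrow> shortfall k L A a" for a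
      unfolding shortfall_def share_def by (intro tendsto_intros limL) (use k in auto)
    have "(\<lambda>i. X (g i) $ j * (\<Sum>a\<in>UNIV. shortfall k (l (g i)) A a))
        \<longlonglongrightarrow> x $ j * (\<Sum>a\<in>UNIV. shortfall k L A a)"
      by (intro tendsto_intros sf limX)
    then show ?thesis using eq[of "g _"] sf[of j] by (simp add: BA LIMSEQ_unique)
  qed
  ultimately show ?thesis using p(1) B(1) unfolding xL A_def by blast
qed

text \<open>
  If the total shortfall were positive, the non-empty pieces would be exactly those that get less
  than the share \<open>1/n\<close>. A hungry player's set inside the set \<open>S\<close> of non-empty pieces spends
  everything on \<open>S\<close>, and one that contains \<open>S\<close> spends \<open>|S|/k \<ge> |S|/n\<close> on it; either way \<open>S\<close>
  would get at least \<open>|S|/n\<close> in total. Hence there is no shortfall, and all shares are equal.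
\<close>

lemma balanced_equilibrium:
  fixes D :: "'n::finite \<Rightarrow> 'n preferences"
  assumes k: "1 \<le> k" and cov: "\<And>s. covering_preferences k (D s)"
    and cl: "\<And>s. closed_preferences k (D s)" and hungry: "\<And>s. hungry k (D s)"
  shows "\<exists>x\<in>divisions. \<exists>A w. (\<forall>s. card (A s) = k \<and> x \<in> D s (A s)) \<and> (\<forall>s. 0 \<le> w s)
           \<and> (\<forall>j. (\<Sum>s\<in>UNIV. w s * of_bool (j \<in> A s)) = (1::real))"
proof -
  obtain x l A where x: "x \<in> divisions" and l: "l \<in> divisions"
    and A: "\<And>s. card (A s) = k" "\<And>s. x \<in> D s (A s)"
    and eq: "\<And>j. x $ j * (\<Sum>i\<in>UNIV. shortfall k l A i) = shortfall k l A j"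
    using equilibrium[of k D, OF k cov cl] by metis
  define n where "n = real CARD('n)"
  have n: "0 < n" by (simp add: n_def)
  define th where "th = (\<Sum>i\<in>UNIV. shortfall k l A i)"
  have l0: "0 \<le> l $ s" and l1: "(\<Sum>s\<in>UNIV. l $ s) = 1" for s using l by (auto simp: divisions_def)
  have sf0: "0 \<le> shortfall k l A j" for j by (simp add: shortfall_def)
  have kn: "real k \<le> n"
    using card_mono[of UNIV "A undefined"] A(1) by (simp add: n_def)
  have share_sum: "(\<Sum>j\<in>X. share k l A j) = (\<Sum>s\<in>UNIV. l $ s * (real (card (X \<inter> A s)) / real k))" for X
  proof -
    have "(\<Sum>j\<in>X. share k l A j) = (\<Sum>j\<in>X. \<Sum>s\<in>UNIV. l $ s * of_bool (j \<in> A s)) / real k"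
      by (simp add: share_def sum_divide_distrib)
    also have "(\<Sum>j\<in>X. \<Sum>s\<in>UNIV. l $ s * of_bool (j \<in> A s)) = (\<Sum>s\<in>UNIV. \<Sum>j\<in>X. l $ s * of_bool (j \<in> A s))"
      by (rule sum.swap)
    also have "\<dots> = (\<Sum>s\<in>UNIV. l $ s * real (card (X \<inter> A s)))"
      by (simp add: of_bool_def sum.If_cases Int_def sum_distrib_left[symmetric])
    finally show ?thesis by (simp add: sum_divide_distrib)
  qed
  have "th = 0"
  proof (rule ccontr)
    assume "th \<noteq> 0"
    then have th: "0 < th" using sf0 by (simp add: th_def order_less_le sum_nonneg)
    define S where "S = {j. \<not> empty_piece x j}"
    have S_iff: "j \<in> S \<longleftrightarrow> share k l A j < 1 / n" for j
    proof -
      have "j \<in> S \<longleftrightarrow> shortfall k l A j \<noteq> 0"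
        using eq[of j] th by (auto simp: S_def empty_piece_def th_def)
      then show ?thesis by (auto simp: shortfall_def n_def max_def)
    qed
    have "S \<noteq> {}"
    proof
      assume "S = {}"
      then have "(\<Sum>j\<in>UNIV. x $ j) = 0" by (simp add: S_def empty_piece_def)
      then show False using x by (simp add: divisions_def)
    qed
    then have less: "(\<Sum>j\<in>S. share k l A j) < (\<Sum>j\<in>S. 1 / n)"
      by (intro sum_strict_mono) (auto simp: S_iff)
    have "real (card S) / n \<le> real (card (S \<inter> A s)) / real k" for s
    proof (cases "A s \<subseteq> S")
      case True
      then have "S \<inter> A s = A s" by blast
      then show ?thesis using A(1)[of s] k n card_mono[of UNIV S] by (simp add: n_def)
    next
      case False
      then have "S \<subseteq> A s"
        using hungry[of s] x A[of s] by (auto simp: hungry_def S_def)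
      then have "S \<inter> A s = S" by blast
      then show ?thesis using kn k n by (simp add: divide_left_mono)
    qed
    then have "(\<Sum>s\<in>UNIV. l $ s * (real (card S) / n)) \<le> (\<Sum>j\<in>S. share k l A j)"
      unfolding share_sum using l0 by (intro sum_mono mult_left_mono) auto
    moreover have "(\<Sum>s\<in>UNIV. l $ s * (real (card S) / n)) = real (card S) / n"
      using l1 by (simp only: sum_distrib_right[symmetric] mult_1_left)
    ultimately show False using less by simp
  qed
  then have ge: "1 / n \<le> share k l A j" for j
    using eq[of j] by (simp add: th_def shortfall_def n_def max_def split: if_splits)
  have "(\<Sum>j\<in>UNIV. share k l A j - 1 / n) = 0"
    using k l1 A(1) n unfolding sum_subtractf share_sum by (simp add: n_def)
  then have "share k l A j = 1 / n" for j
    using ge by (simp add: sum_nonneg_eq_0_iff)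
  moreover have "(\<Sum>s\<in>UNIV. (n / real k * l $ s) * of_bool (j \<in> A s)) = n * share k l A j" for j
    unfolding share_def sum_divide_distrib sum_distrib_left by (intro sum.cong) auto
  ultimately have "(\<Sum>s\<in>UNIV. (n / real k * l $ s) * of_bool (j \<in> A s)) = 1" for j
    using n by simp
  then show ?thesis using x A n l0 by (intro bexI[of _ x] exI[of _ A] exI[of _ "\<lambda>s. n / real k * l $ s"]) auto
qed

section \<open>From slots to players\<close>

lemma card_residue_class_le:
  fixes p n r :: nat
  assumes "0 < p"
  shows "card {i. i < n \<and> i mod p = r} \<le> (n + p - 1) div p"
proof -
  have "inj_on (\<lambda>i. i div p) {i. i < n \<and> i mod p = r}"
    by (rule inj_onI) (metis (mono_tags, lifting) div_mult_mod_eq mem_Collect_eq)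
  moreover have "(\<lambda>i. i div p) ` {i. i < n \<and> i mod p = r} \<subseteq> {..<(n + p - 1) div p}"
  proof safe
    fix i assume "i < n"
    then have "(i + p) div p \<le> (n + p - 1) div p" by (intro div_le_mono) simp
    then show "i div p < (n + p - 1) div p" using assms by simp
  qed
  ultimately have "card {i. i < n \<and> i mod p = r} \<le> card {..<(n + p - 1) div p}"
    by (intro card_inj_on_le) auto
  then show ?thesis by simp
qed

text \<open>
  Slots are dealt to the players cyclically, so that no player holds more than \<open>\<lceil>n/p\<rceil>\<close> of them.
  A player who receives several disjoint sets keeps one.
\<close>

lemma satisfiable_players:
  fixes C :: "nat \<Rightarrow> 'n::finite preferences"
  assumes "1 \<le> k" "1 \<le> p"
    and hungry: "\<And>i. i \<in> {1..p} \<Longrightarrow> hungry k (C i)"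
    and cov: "\<And>i. i \<in> {1..p} \<Longrightarrow> covering_preferences k (C i)"
    and cl: "\<And>i. i \<in> {1..p} \<Longrightarrow> closed_preferences k (C i)"
  shows "\<exists>x\<in>divisions. \<exists>N\<subseteq>{1..p}. jointly_satisfiable k C x N
           \<and> real CARD('n) \<le> (real k ^ 2 - real k + 1)
                * (real ((CARD('n) + p - 1) div p) * real (card N))"
proof -
  obtain h :: "'n \<Rightarrow> nat" where h: "bij_betw h UNIV {0..<CARD('n)}"
    using ex_bij_betw_finite_nat[of "UNIV :: 'n set"] by auto
  define own where "own s = Suc (h s mod p)" for s
  have own: "own s \<in> {1..p}" for s using \<open>1 \<le> p\<close> by (simp add: own_def Suc_le_eq)
  obtain x A w where x: "x \<in> divisions" and A: "\<And>s. card (A s) = k" "\<And>s. x \<in> C (own s) (A s)"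
    and w: "\<And>s. 0 \<le> w s" "\<And>j. (\<Sum>s\<in>UNIV. w s * of_bool (j \<in> A s)) = (1::real)"
    using balanced_equilibrium[of k "\<lambda>s. C (own s)"] \<open>1 \<le> k\<close> cov cl hungry own by metis
  obtain I where I: "disjoint_family_on A I"
    and cI: "real CARD('n) \<le> (real k ^ 2 - real k + 1) * real (card I)"
    using disjoint_subfamily_of_balanced_family[of UNIV UNIV k A w] \<open>1 \<le> k\<close> A(1) w by auto
  define N where "N = own ` I"
  define a where "a i = (SOME s. s \<in> I \<and> own s = i)" for i
  have a: "a i \<in> I \<and> own (a i) = i" if "i \<in> N" for i
    unfolding a_def by (rule someI_ex) (use that in \<open>auto simp: N_def\<close>)
  have "disjoint_family_on (\<lambda>i. A (a i)) N"
    unfolding disjoint_family_on_def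
  proof (intro ballI impI)
    fix i j assume "i \<in> N" "j \<in> N" "i \<noteq> j"
    then show "A (a i) \<inter> A (a j) = {}"
      using a[of i] a[of j] I by (metis disjoint_family_onD)
  qed
  moreover have "\<forall>i\<in>N. card (A (a i)) = k \<and> x \<in> C i (A (a i))"
    using A a by metis
  ultimately have "jointly_satisfiable k C x N"
    unfolding jointly_satisfiable_def by (intro exI[of _ "\<lambda>i. A (a i)"]) auto
  moreover have "N \<subseteq> {1..p}" using own by (auto simp: N_def)
  moreover have card_I: "card I \<le> (CARD('n) + p - 1) div p * card N"
  proof -
    have "card {s. own s = i} \<le> (CARD('n) + p - 1) div p" for i
    proof -
      have "h ` {s. own s = i} \<subseteq> {r. r < CARD('n) \<and> r mod p = i - 1}"
        using h by (auto simp: own_def bij_betw_def)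
      then have "card (h ` {s. own s = i}) \<le> card {r. r < CARD('n) \<and> r mod p = i - 1}"
        by (intro card_mono) auto
      also have "\<dots> \<le> (CARD('n) + p - 1) div p"
        using \<open>1 \<le> p\<close> by (intro card_residue_class_le) simp
      finally have "card (h ` {s. own s = i}) \<le> (CARD('n) + p - 1) div p" .
      moreover have "inj_on h {s. own s = i}" using h by (auto simp: bij_betw_def intro: inj_on_subset)
      ultimately show ?thesis by (simp add: card_image)
    qed
    then have "(\<Sum>i\<in>N. card {s. own s = i}) \<le> (\<Sum>i\<in>N. (CARD('n) + p - 1) div p)"
      by (intro sum_mono)
    moreover have "card I \<le> card (\<Union>i\<in>N. {s. own s = i})"
      by (rule card_mono) (auto simp: N_def)
    moreover have "card (\<Union>i\<in>N. {s. own s = i}) \<le> (\<Sum>i\<in>N. card {s. own s = i})"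
      by (rule card_UN_le) (simp add: N_def)
    ultimately show ?thesis by (simp add: mult.commute)
  qed
  moreover have "real CARD('n) \<le> (real k ^ 2 - real k + 1)
      * (real ((CARD('n) + p - 1) div p) * real (card N))"
  proof -
    have "real k * 1 \<le> real k * real k" using \<open>1 \<le> k\<close> by (intro mult_left_mono) auto
    then have "0 \<le> real k ^ 2 - real k + 1" by (simp add: power2_eq_square)
    moreover have "real (card I) \<le> real ((CARD('n) + p - 1) div p) * real (card N)"
      using card_I by (metis of_nat_le_iff of_nat_mult)
    ultimately show ?thesis using cI mult_left_mono order_trans by blast
  qed
  ultimately show ?thesis using x by blast
qed

theorem theorem1p1:
  fixes n k p :: nat
    and C :: "nat \<Rightarrow> 'n::finite preferences"
  assumes "CARD('n) = n"
    and "1 \<le> n" and "1 \<le> k" and "1 \<le> p" and "p \<le> n"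
    and "\<And>i. i \<in> {1..p} \<Longrightarrow> preference_family k (C i)"
    and "\<And>i. i \<in> {1..p} \<Longrightarrow> hungry k (C i)"
    and "\<And>i. i \<in> {1..p} \<Longrightarrow> covering_preferences k (C i)"
    and "\<And>i. i \<in> {1..p} \<Longrightarrow> closed_preferences k (C i)"
  shows "(\<exists>x\<in>divisions. \<exists>N\<subseteq>{1..p}.
            int (card N) \<ge> \<lceil>real p / (2 * (real k ^ 2 - real k + 1))\<rceil>
            \<and> jointly_satisfiable k C x N)
       \<and> (p dvd n \<longrightarrow>
          (\<exists>x\<in>divisions. \<exists>N\<subseteq>{1..p}.
            int (card N) \<ge> \<lceil>real p / (real k ^ 2 - real k + 1)\<rceil>
            \<and> jointly_satisfiable k C x N))"
proof -
  define q where "q = real k ^ 2 - real k + 1"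
  define m where "m = (n + p - 1) div p"
  have "real k * 1 \<le> real k * real k" using \<open>1 \<le> k\<close> by (intro mult_left_mono) auto
  then have q: "0 < q" by (simp add: q_def power2_eq_square)
  obtain x N where x: "x \<in> divisions" and N: "N \<subseteq> {1..p}" "jointly_satisfiable k C x N"
    and c: "real n \<le> q * (real m * real (card N))"
    using satisfiable_players[of k p C] assms unfolding q_def m_def by metis
  \<comment> \<open>The factor \<open>b\<close> measures the loss from rounding \<open>n/p\<close> up to \<open>m\<close>: it is \<open>2\<close> in general and \<open>1\<close>
      if \<open>p\<close> divides \<open>n\<close>.\<close>
  have bound: "\<lceil>real p / (b * q)\<rceil> \<le> int (card N)" if "real (m * p) \<le> b * real n" "0 < b" for b
  proof -
    have "real p * real n \<le> real p * (q * (real m * real (card N)))"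
      using c by (intro mult_left_mono) auto
    also have "\<dots> = real (m * p) * (q * real (card N))" by simp
    also have "\<dots> \<le> b * real n * (q * real (card N))"
      using that(1) q by (intro mult_right_mono) auto
    finally have "real n * real p \<le> real n * (b * q * real (card N))" by (simp add: mult_ac)
    then have "real p \<le> b * q * real (card N)" using \<open>1 \<le> n\<close> by simp
    then have "real p / (b * q) \<le> real (card N)" using q that(2) by (simp add: pos_divide_le_eq mult_ac)
    then show ?thesis by (simp add: ceiling_le_iff)
  qed
  have "m * p \<le> n + p - 1" by (simp add: m_def)
  then have "real (m * p) \<le> real (2 * n)" using \<open>p \<le> n\<close> unfolding of_nat_le_iff by linarith
  then have "\<lceil>real p / (2 * q)\<rceil> \<le> int (card N)" by (intro bound) auto
  moreover have "\<lceil>real p / q\<rceil> \<le> int (card N)" if pn: "p dvd n"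
  proof -
    obtain d where d: "n = p * d" using pn by blast
    have "m = ((p - 1) + p * d) div p" using \<open>1 \<le> p\<close> by (simp add: m_def d add.commute)
    then have "m = d" using \<open>1 \<le> p\<close> by (simp only: div_mult_self2) simp
    then show ?thesis using bound[of 1] d by simp
  qed
  ultimately show ?thesis using x N unfolding q_def by blast
qed

end
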